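(* Let $\sigma > 0$ and let $s$ be the unique maximal real solution of $s''(t) = 2 s(t)^3 + t\, s(t)$ with $s(0) = 0$ and $s'(0) = \sigma$, defined on its maximal open interval of existence $I_s \ni 0$. If $0 < \tau \in I_s$, then $\tau + s(\tau)^{-1} \notin I_s$.
   Context: All functions are real-valued functions of a real variable $t$. The maximal interval $I_s$ is the largest open interval about $0$ on which the solution of the initial value problem exists. (The solution satisfies $s(t) > 0$ for every $t > 0$ in $I_s$, so $s(\tau)^{-1}$ makes sense.) *)

theory Defs
  imports "HOL-Analysis.Analysis"
begin

text \<open>
  A solution on \<open>I\<close> is a total function of which only the values on \<open>I\<close> matter: since \<open>I\<close> is open,
  the derivatives at points of \<open>I\<close> are determined by these values.
\<close>

definition ivp_solution :: "real \<Rightarrow> real set \<Rightarrow> (real \<Rightarrow> real) \<Rightarrow> bool" where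
  "ivp_solution \<sigma> I s \<longleftrightarrow>
     open I \<and> is_interval I \<and> 0 \<in> I \<and>
     (\<forall>t\<in>I. (s has_real_derivative deriv s t) (at t)) \<and>
     (\<forall>t\<in>I. (deriv s has_real_derivative 2 * s t ^ 3 + t * s t) (at t)) \<and>
     s 0 = 0 \<and> deriv s 0 = \<sigma>"

text \<open>
  Solutions of the initial value problem agree on the intersection of their intervals, so the largest
  interval carrying some solution is the domain of the solution that extends all others.
\<close>

definition maximal_ivp_solution :: "real \<Rightarrow> real set \<Rightarrow> (real \<Rightarrow> real) \<Rightarrow> bool" where
  "maximal_ivp_solution \<sigma> I s \<longleftrightarrow>
     ivp_solution \<sigma> I s \<and> (\<forall>J u. ivp_solution \<sigma> J u \<longrightarrow> J \<subseteq> I)"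

end

theory Submission
  imports Defs
begin

text \<open>
  The argument rests on the energy \<open>E = s'\<^sup>2 - s\<^sup>4\<close>, which would be conserved by the autonomous
  equation \<open>s'' = 2 s\<^sup>3\<close>; the extra term \<open>t s\<close> makes \<open>E' = 2 t (s s')\<close>. For \<open>t \<ge> 0\<close> this is
  nonnegative, because \<open>s s'\<close> starts at \<open>0\<close> and has the derivative
  \<open>s'\<^sup>2 + s s'' = s'\<^sup>2 + 2 s\<^sup>4 + t s\<^sup>2 \<ge> 0\<close>. Hence \<open>s'\<^sup>2 \<ge> s\<^sup>4 + \<sigma>\<^sup>2\<close> to the right of \<open>0\<close>
  (\<open>ivp_energy_bound\<close>). In particular \<open>s'\<close> never vanishes there, so it keeps the sign of \<open>\<sigma>\<close>:
  \<open>s\<close> is positive and \<open>s' \<ge> s\<^sup>2\<close> (\<open>ivp_deriv_ge_square\<close>).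

  The Riccati inequality \<open>s' \<ge> s\<^sup>2\<close> says that \<open>1 / s(t) + t\<close> is nonincreasing. If the solution
  lived up to \<open>T = \<tau> + 1 / s(\<tau>)\<close>, then \<open>1 / s(T) + T \<le> 1 / s(\<tau>) + \<tau> = T\<close>, contradicting
  \<open>s(T) > 0\<close>. So no solution extends as far as \<open>T\<close>.
\<close>

lemma ivp_solution_deriv:
  assumes "ivp_solution \<sigma> I s" "t \<in> I"
  shows "(s has_real_derivative deriv s t) (at t)"
    and "(deriv s has_real_derivative 2 * s t ^ 3 + t * s t) (at t)"
  using assms by (auto simp: ivp_solution_def)

lemma ivp_solution_interval:
  assumes "ivp_solution \<sigma> I s" "b \<in> I" "0 \<le> x" "x \<le> b"
  shows "x \<in> I"
  using assms mem_is_interval_1_I[of I 0 b x] by (auto simp: ivp_solution_def)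

text \<open>
  Monotonicity of \<open>s s'\<close> gives the sign of this product, and with it the sign of \<open>E'\<close>, before
  anything is known about the signs of \<open>s\<close> and \<open>s'\<close> separately.
\<close>

lemma ivp_mult_deriv_nonneg:
  assumes sol: "ivp_solution \<sigma> I s" and "t \<in> I" "0 \<le> t"
  shows "0 \<le> s t * deriv s t"
proof -
  have "s 0 * deriv s 0 \<le> s t * deriv s t"
  proof (rule DERIV_nonneg_imp_nondecreasing[OF \<open>0 \<le> t\<close>])
    fix x assume x: "0 \<le> x" "x \<le> t"
    note d = ivp_solution_deriv[OF sol ivp_solution_interval[OF sol \<open>t \<in> I\<close> x]]
    have "((\<lambda>x. s x * deriv s x) has_real_derivative
            (deriv s x)\<^sup>2 + 2 * s x ^ 4 + x * (s x)\<^sup>2) (at x)"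
      by (rule derivative_eq_intros d refl)+ (simp add: power2_eq_square eval_nat_numeral algebra_simps)
    moreover have "0 \<le> (deriv s x)\<^sup>2 + 2 * s x ^ 4 + x * (s x)\<^sup>2"
      using x by simp
    ultimately show "\<exists>y. ((\<lambda>x. s x * deriv s x) has_real_derivative y) (at x) \<and> 0 \<le> y"
      by blast
  qed
  then show ?thesis
    using sol by (simp add: ivp_solution_def)
qed

lemma ivp_energy_bound:
  assumes sol: "ivp_solution \<sigma> I s" and "t \<in> I" "0 \<le> t"
  shows "s t ^ 4 + \<sigma>\<^sup>2 \<le> (deriv s t)\<^sup>2"
proof -
  have "(deriv s 0)\<^sup>2 - s 0 ^ 4 \<le> (deriv s t)\<^sup>2 - s t ^ 4"
  proof (rule DERIV_nonneg_imp_nondecreasing[OF \<open>0 \<le> t\<close>])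
    fix x assume x: "0 \<le> x" "x \<le> t"
    have xI: "x \<in> I"
      using ivp_solution_interval[OF sol \<open>t \<in> I\<close> x] .
    note d = ivp_solution_deriv[OF sol xI]
    have "((\<lambda>x. (deriv s x)\<^sup>2 - s x ^ 4) has_real_derivative 2 * x * (s x * deriv s x)) (at x)"
      by (rule derivative_eq_intros d refl)+ (simp add: power2_eq_square eval_nat_numeral algebra_simps)
    moreover have "0 \<le> 2 * x * (s x * deriv s x)"
      using x ivp_mult_deriv_nonneg[OF sol xI] by simp
    ultimately show "\<exists>y. ((\<lambda>x. (deriv s x)\<^sup>2 - s x ^ 4) has_real_derivative y) (at x) \<and> 0 \<le> y"
      by blast
  qed
  then show ?thesis
    using sol by (simp add: ivp_solution_def)
qed

text \<open>
  The energy bound keeps \<open>s'\<close> away from \<open>0\<close>, so by continuity \<open>s'\<close> cannot change sign.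
\<close>

lemma ivp_deriv_pos:
  assumes sol: "ivp_solution \<sigma> I s" and "\<sigma> > 0" "t \<in> I" "0 \<le> t"
  shows "0 < deriv s t"
proof (rule ccontr)
  assume "\<not> 0 < deriv s t"
  moreover have "deriv s 0 = \<sigma>"
    using sol by (simp add: ivp_solution_def)
  moreover have "\<forall>x. 0 \<le> x \<and> x \<le> t \<longrightarrow> isCont (deriv s) x"
    using ivp_solution_deriv(2)[OF sol] ivp_solution_interval[OF sol \<open>t \<in> I\<close>] DERIV_isCont
    by blast
  ultimately obtain x where x: "0 \<le> x" "x \<le> t" "deriv s x = 0"
    using IVT2[of "deriv s" t 0 0] \<open>\<sigma> > 0\<close> \<open>0 \<le> t\<close> by auto
  have "s x ^ 4 + \<sigma>\<^sup>2 \<le> 0"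
    using ivp_energy_bound[OF sol ivp_solution_interval[OF sol \<open>t \<in> I\<close> x(1,2)] x(1)] x(3) by simp
  moreover have "0 < s x ^ 4 + \<sigma>\<^sup>2"
    using \<open>\<sigma> > 0\<close> by (intro add_nonneg_pos) simp_all
  ultimately show False
    by simp
qed

lemma ivp_solution_pos:
  assumes sol: "ivp_solution \<sigma> I s" and "\<sigma> > 0" "t \<in> I" "0 < t"
  shows "0 < s t"
proof -
  have "s 0 < s t"
  proof (rule DERIV_pos_imp_increasing[OF \<open>0 < t\<close>])
    fix x assume x: "0 \<le> x" "x \<le> t"
    have "x \<in> I"
      using ivp_solution_interval[OF sol \<open>t \<in> I\<close> x] .
    then show "\<exists>y. (s has_real_derivative y) (at x) \<and> 0 < y"
      using ivp_solution_deriv(1)[OF sol] ivp_deriv_pos[OF sol \<open>\<sigma> > 0\<close>] x(1) by blast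
  qed
  then show ?thesis
    using sol by (simp add: ivp_solution_def)
qed

lemma ivp_deriv_ge_square:
  assumes sol: "ivp_solution \<sigma> I s" and "\<sigma> > 0" "t \<in> I" "0 \<le> t"
  shows "(s t)\<^sup>2 \<le> deriv s t"
proof (rule power2_le_imp_le)
  have "((s t)\<^sup>2)\<^sup>2 \<le> s t ^ 4 + \<sigma>\<^sup>2"
    by simp
  also have "\<dots> \<le> (deriv s t)\<^sup>2"
    using ivp_energy_bound[OF sol] assms by simp
  finally show "((s t)\<^sup>2)\<^sup>2 \<le> (deriv s t)\<^sup>2" .
  show "0 \<le> deriv s t"
    using ivp_deriv_pos[OF assms] by simp
qed

lemma ivp_inverse_plus_id_antimono:
  assumes sol: "ivp_solution \<sigma> I s" and "\<sigma> > 0" "0 < a" "a \<le> b" "b \<in> I"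
  shows "inverse (s b) + b \<le> inverse (s a) + a"
proof (rule DERIV_nonpos_imp_nonincreasing[OF \<open>a \<le> b\<close>])
  fix x assume x: "a \<le> x" "x \<le> b"
  then have "0 < x"
    using \<open>0 < a\<close> by simp
  have xI: "x \<in> I"
    using ivp_solution_interval[OF sol \<open>b \<in> I\<close>] \<open>0 < x\<close> x by simp
  have pos: "0 < s x"
    using ivp_solution_pos[OF sol \<open>\<sigma> > 0\<close> xI \<open>0 < x\<close>] .
  have "((\<lambda>x. inverse (s x) + x) has_real_derivative 1 - deriv s x / (s x)\<^sup>2) (at x)"
    using pos by (auto intro!: derivative_eq_intros ivp_solution_deriv(1)[OF sol xI]
        simp: field_simps power2_eq_square)
  moreover have "1 - deriv s x / (s x)\<^sup>2 \<le> 0"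
    using ivp_deriv_ge_square[OF sol \<open>\<sigma> > 0\<close> xI] \<open>0 < x\<close> pos by simp
  ultimately show "\<exists>y. ((\<lambda>x. inverse (s x) + x) has_real_derivative y) (at x) \<and> y \<le> 0"
    by blast
qed

theorem theorem1:
  fixes \<sigma> \<tau> :: real and s :: "real \<Rightarrow> real" and I :: "real set"
  assumes "\<sigma> > 0"
    and "maximal_ivp_solution \<sigma> I s"
    and "0 < \<tau>" and "\<tau> \<in> I"
  shows "\<tau> + inverse (s \<tau>) \<notin> I"
proof
  define T where "T = \<tau> + inverse (s \<tau>)"
  assume "\<tau> + inverse (s \<tau>) \<in> I"
  then have "T \<in> I"
    by (simp add: T_def)
  have sol: "ivp_solution \<sigma> I s"
    using assms(2) by (simp add: maximal_ivp_solution_def)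
  have "\<tau> \<le> T"
    using ivp_solution_pos[OF sol \<open>\<sigma> > 0\<close> \<open>\<tau> \<in> I\<close> \<open>0 < \<tau>\<close>] by (simp add: T_def)
  have "inverse (s T) + T \<le> T"
    using ivp_inverse_plus_id_antimono[OF sol \<open>\<sigma> > 0\<close> \<open>0 < \<tau>\<close> \<open>\<tau> \<le> T\<close> \<open>T \<in> I\<close>]
    by (simp add: T_def add.commute)
  moreover have "0 < s T"
    using ivp_solution_pos[OF sol \<open>\<sigma> > 0\<close> \<open>T \<in> I\<close>] \<open>0 < \<tau>\<close> \<open>\<tau> \<le> T\<close> by simp
  ultimately show False
    by simp
qed

end
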